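(* Let $T>0$ and $X\in C^2([0,T]^2;\mathbb{R}^d)$. Then the $\mathrm{id}$-signature $\mathbf S^{\mathrm{id}}(X)$, viewed as a $\mathcal T((\mathbb R^d))$-valued function, satisfies for all $\mathbf s=(s_1,s_2),\mathbf t=(t_1,t_2)\in[0,T]^2$ with $s_1\le t_1$, $s_2\le t_2$ the equation $$\mathbf S^{\mathrm{id}}_{\mathbf s\mathbf t}(X)=\mathbf 1+\int_{[\mathbf s,\mathbf t]}\mathbf S^{\mathrm{id}}_{\mathbf s\mathbf r}(X)\otimes dX_{\mathbf r}$$ in $\mathcal T((\mathbb R^d))$.
   Context: $\mathcal T((\mathbb R^d))$ is the algebra of formal tensor series $\sum_w f_w e_w$ ($w$ running over all finite words in $\{1,\dots,d\}$, $e_{(i_1,\dots,i_n)}=e_{i_1}\otimes\cdots\otimes e_{i_n}$, with $e_1,\dots,e_d$ the canonical basis of $\mathbb R^d$) with the tensor product $\otimes$, and $\mathbf 1$ is its unit (the empty word). Integrals of $\mathcal T((\mathbb R^d))$-valued functions are taken coefficientwise. $[\mathbf s,\mathbf t]=[s_1,t_1]\times[s_2,t_2]$; $dX^i_{\mathbf r}=\frac{\partial^2X^i}{\partial r_1\partial r_2}(\mathbf r)\,dr_1dr_2$ and $dX_{\mathbf r}=\sum_{i=1}^d dX^i_{\mathbf r}\,e_i$. $\mathrm{id}$-signature: $\mathbf S^{\mathrm{id}}_{\mathbf s\mathbf t}(X)=\sum_w\langle\mathbf S^{\mathrm{id}}_{\mathbf s\mathbf t}(X),w\rangle e_w$, where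 the coefficient of the empty word is $1$ and for $w=(i_1,\dots,i_n)$, $n\ge1$, $$\langle\mathbf S^{\mathrm{id}}_{\mathbf s\mathbf t}(X),w\rangle=\int_{[\mathbf s,\mathbf t]}\langle\mathbf S^{\mathrm{id}}_{\mathbf s\mathbf r}(X),(i_1,\dots,i_{n-1})\rangle\,dX^{i_n}_{\mathbf r};$$ equivalently it is $\int_{\Delta^n_{[\mathbf s,\mathbf t]}}dX^{i_1}_{\mathbf r^1}\cdots dX^{i_n}_{\mathbf r^n}$ with $\Delta^n_{[\mathbf s,\mathbf t]}=\{(\mathbf r^1,\dots,\mathbf r^n): s_1\le r_1^1\le\dots\le r_1^n\le t_1,\ s_2\le r_2^1\le\dots\le r_2^n\le t_2\}$. *)

theory Defs
  imports "HOL-Analysis.Analysis"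
begin

text \<open>
  Throughout, the finite type \<open>'d\<close> plays the role of the alphabet \<open>{1,\<dots>,d}\<close>, a word is an element
  of \<open>'d list\<close>, and a point of the plane is a pair \<open>r = (r\<^sub>1, r\<^sub>2) :: real \<times> real\<close>. For pairs,
  \<open>cbox s t = {fst s..fst t} \<times> {snd s..snd t}\<close> (see \<open>cbox_Pair_eq\<close>).
\<close>

section \<open>The algebra of formal tensor series\<close>

typedef 'd tensor_series = "UNIV :: ('d list \<Rightarrow> real) set"
  morphisms tcoeff Tensor_Series ..

setup_lifting type_definition_tensor_series

lemma tensor_series_eqI: "(\<And>w. tcoeff f w = tcoeff g w) \<Longrightarrow> f = g"
  by transfer auto

text \<open>The multiplication is the tensor product, determined by \<open>e\<^sub>u \<otimes> e\<^sub>v = e\<^bsub>u@v\<^esub>\<close>: the coefficient of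
  \<open>w\<close> is the sum over all ways of cutting \<open>w\<close> into a prefix and a suffix.\<close>

instantiation tensor_series :: (type) real_algebra_1
begin

lift_definition zero_tensor_series :: "'a tensor_series" is "\<lambda>w. 0" .

lift_definition one_tensor_series :: "'a tensor_series" is "\<lambda>w. if w = [] then 1 else 0" .

lift_definition plus_tensor_series :: "'a tensor_series \<Rightarrow> 'a tensor_series \<Rightarrow> 'a tensor_series"
  is "\<lambda>f g w. f w + g w" .

lift_definition minus_tensor_series :: "'a tensor_series \<Rightarrow> 'a tensor_series \<Rightarrow> 'a tensor_series"
  is "\<lambda>f g w. f w - g w" .

lift_definition uminus_tensor_series :: "'a tensor_series \<Rightarrow> 'a tensor_series"
  is "\<lambda>f w. - f w" .

lift_definition scaleR_tensor_series :: "real \<Rightarrow> 'a tensor_series \<Rightarrow> 'a tensor_series"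
  is "\<lambda>c f w. c * f w" .

lift_definition times_tensor_series :: "'a tensor_series \<Rightarrow> 'a tensor_series \<Rightarrow> 'a tensor_series"
  is "\<lambda>f g w. \<Sum>k\<le>length w. f (take k w) * g (drop k w)" .

instance
proof
  fix a b c :: "'a tensor_series" and x y :: real
  show "a + b + c = a + (b + c)" "a + b = b + a" "0 + a = a" "- a + a = 0" "a - b = a + - b"
    by (transfer; simp add: fun_eq_iff)+
  show "x *\<^sub>R (a + b) = x *\<^sub>R a + x *\<^sub>R b" "(x + y) *\<^sub>R a = x *\<^sub>R a + y *\<^sub>R a"
    "x *\<^sub>R y *\<^sub>R a = (x * y) *\<^sub>R a" "1 *\<^sub>R a = a"
    by (transfer; simp add: fun_eq_iff algebra_simps)+
  show "(a + b) * c = a * c + b * c" "a * (b + c) = a * b + a * c"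
    by (transfer; simp add: fun_eq_iff algebra_simps sum.distrib)+
  show "x *\<^sub>R a * b = x *\<^sub>R (a * b)" "a * x *\<^sub>R b = x *\<^sub>R (a * b)"
    by (transfer; simp add: fun_eq_iff sum_distrib_left mult_ac)+
  show "(0::'a tensor_series) \<noteq> 1"
    by transfer (auto simp: fun_eq_iff)
  show "1 * a = a"
  proof (transfer, rule ext)
    fix a :: "'a list \<Rightarrow> real" and w
    have "(\<Sum>k\<le>length w. (if take k w = [] then 1 else 0) * a (drop k w))
        = (\<Sum>k\<le>length w. if k = 0 then a w else 0)"
      by (rule sum.cong) auto
    then show "(\<Sum>k\<le>length w. (if take k w = [] then 1 else 0) * a (drop k w)) = a w"
      by simp
  qed
  show "a * 1 = a"
  proof (transfer, rule ext)
    fix a :: "'a list \<Rightarrow> real" and w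
    have "(\<Sum>k\<le>length w. a (take k w) * (if drop k w = [] then 1 else 0))
        = (\<Sum>k\<le>length w. if k = length w then a w else 0)"
      by (rule sum.cong) auto
    then show "(\<Sum>k\<le>length w. a (take k w) * (if drop k w = [] then 1 else 0)) = a w"
      by simp
  qed
  show "a * b * c = a * (b * c)"
  proof (transfer, rule ext)
    fix a b c :: "'a list \<Rightarrow> real" and w
    have "(\<Sum>k\<le>length w. (\<Sum>j\<le>length (take k w). a (take j (take k w)) * b (drop j (take k w))) * c (drop k w))
        = (\<Sum>(k,j)\<in>(SIGMA k:{..length w}. {..k}). a (take j w) * (b (drop j (take k w)) * c (drop k w)))"
      by (subst sum.Sigma [symmetric])
         (auto simp: sum_distrib_right mult.assoc min_def intro!: sum.cong)
    also have "\<dots> = (\<Sum>(j,m)\<in>(SIGMA j:{..length w}. {..length w - j}).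
                      a (take j w) * (b (take m (drop j w)) * c (drop m (drop j w))))"
      by (rule sum.reindex_bij_witness
            [where i = "\<lambda>(j,m). (j + m, j)" and j = "\<lambda>(k,j). (j, k - j)"])
         (auto simp: drop_take add.commute)
    also have "\<dots> = (\<Sum>j\<le>length w. a (take j w) *
                      (\<Sum>m\<le>length (drop j w). b (take m (drop j w)) * c (drop m (drop j w))))"
      by (subst sum.Sigma [symmetric]) (auto simp: sum_distrib_left)
    finally show "(\<Sum>k\<le>length w. (\<Sum>j\<le>length (take k w). a (take j (take k w)) * b (drop j (take k w))) * c (drop k w))
        = (\<Sum>j\<le>length w. a (take j w) *
            (\<Sum>m\<le>length (drop j w). b (take m (drop j w)) * c (drop m (drop j w))))" .
  qed
qed

end

lift_definition tensor_basis :: "'d list \<Rightarrow> 'd tensor_series" ("\<e>")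
  is "\<lambda>w v. if v = w then 1 else 0" .

lemma tensor_basis_Nil: "\<e> [] = 1"
  by transfer simp

lemma tensor_basis_mult: "\<e> u * \<e> v = \<e> (u @ v)"
proof (rule tensor_series_eqI)
  fix w
  have *: "(take k w = u \<and> drop k w = v) \<longleftrightarrow> (k = length u \<and> w = u @ v)" if "k \<le> length w" for k
    using that by (metis append_eq_conv_conj append_take_drop_id length_take min.absorb2)
  have "tcoeff (\<e> u * \<e> v) w = (\<Sum>k\<le>length w. if k = length u \<and> w = u @ v then 1 else 0)"
    unfolding times_tensor_series.rep_eq tensor_basis.rep_eq
    by (rule sum.cong) (use * in auto)
  also have "\<dots> = tcoeff (\<e> (u @ v)) w"
    by (auto simp: tensor_basis.rep_eq)
  finally show "tcoeff (\<e> u * \<e> v) w = tcoeff (\<e> (u @ v)) w" .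
qed

text \<open>Integrals of tensor-series-valued functions are coefficientwise.\<close>

definition tensor_integrable_on ::
    "('a::euclidean_space \<Rightarrow> 'd tensor_series) \<Rightarrow> 'a set \<Rightarrow> bool"  (infixr "tensor'_integrable'_on" 46)
  where "F tensor_integrable_on A \<longleftrightarrow> (\<forall>w. (\<lambda>r. tcoeff (F r) w) integrable_on A)"

definition tensor_integral ::
    "'a::euclidean_space set \<Rightarrow> ('a \<Rightarrow> 'd tensor_series) \<Rightarrow> 'd tensor_series"
  where "tensor_integral A F = Tensor_Series (\<lambda>w. integral A (\<lambda>r. tcoeff (F r) w))"

section \<open>Twice continuously differentiable fields on a square\<close>

text \<open>Derivatives are taken within \<open>S\<close>, hence are one-sided at boundary points of the square.\<close>

definition C2_on :: "'a::euclidean_space set \<Rightarrow> ('a \<Rightarrow> 'b::euclidean_space) \<Rightarrow> bool"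
  where "C2_on S f \<longleftrightarrow>
    (\<exists>(f' :: 'a \<Rightarrow> 'a \<Rightarrow>\<^sub>L 'b) (f'' :: 'a \<Rightarrow> 'a \<Rightarrow>\<^sub>L ('a \<Rightarrow>\<^sub>L 'b)).
      (\<forall>x\<in>S. (f has_derivative blinfun_apply (f' x)) (at x within S)) \<and>
      (\<forall>x\<in>S. (f' has_derivative blinfun_apply (f'' x)) (at x within S)) \<and>
      continuous_on S f'')"

definition partial1 :: "real \<Rightarrow> (real \<times> real \<Rightarrow> real) \<Rightarrow> real \<times> real \<Rightarrow> real"
  where "partial1 T f r = vector_derivative (\<lambda>u. f (u, snd r)) (at (fst r) within {0..T})"

definition partial2 :: "real \<Rightarrow> (real \<times> real \<Rightarrow> real) \<Rightarrow> real \<times> real \<Rightarrow> real"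
  where "partial2 T f r = vector_derivative (\<lambda>u. f (fst r, u)) (at (snd r) within {0..T})"

text \<open>The density of \<open>dX\<^sup>i\<close> with respect to \<open>dr\<^sub>1 dr\<^sub>2\<close>.\<close>

definition mixed_partial :: "real \<Rightarrow> (real \<times> real \<Rightarrow> real ^ 'd) \<Rightarrow> 'd \<Rightarrow> real \<times> real \<Rightarrow> real"
  where "mixed_partial T X i = partial1 T (partial2 T (\<lambda>r. X r $ i))"

text \<open>The density of \<open>dX = \<Sum>\<^sub>i dX\<^sup>i e\<^sub>i\<close>.\<close>

definition dX_density :: "real \<Rightarrow> (real \<times> real \<Rightarrow> real ^ 'd::finite) \<Rightarrow> real \<times> real \<Rightarrow> 'd tensor_series"
  where "dX_density T X r = (\<Sum>i\<in>UNIV. mixed_partial T X i r *\<^sub>R \<e> [i])"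

section \<open>The id-signature\<close>

function id_sig_coeff ::
    "real \<Rightarrow> (real \<times> real \<Rightarrow> real ^ 'd) \<Rightarrow> real \<times> real \<Rightarrow> 'd list \<Rightarrow> real \<times> real \<Rightarrow> real"
  where "id_sig_coeff T X s w t =
    (if w = [] then 1
     else integral (cbox s t) (\<lambda>r. id_sig_coeff T X s (butlast w) r * mixed_partial T X (last w) r))"
  by pat_completeness auto
termination
  by (relation "Wellfounded.measure (\<lambda>(T, X, s, w, t). length w)") auto

declare id_sig_coeff.simps [simp del]

lemma id_sig_coeff_Nil: "id_sig_coeff T X s [] t = 1"
  by (simp add: id_sig_coeff.simps)

lemma id_sig_coeff_snoc:
  "id_sig_coeff T X s (w @ [i]) t =
    integral (cbox s t) (\<lambda>r. id_sig_coeff T X s w r * mixed_partial T X i r)"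
  by (subst id_sig_coeff.simps) simp

definition id_signature ::
    "real \<Rightarrow> (real \<times> real \<Rightarrow> real ^ 'd) \<Rightarrow> real \<times> real \<Rightarrow> real \<times> real \<Rightarrow> 'd tensor_series"
  where "id_signature T X s t = Tensor_Series (\<lambda>w. id_sig_coeff T X s w t)"

end

theory Submission
  imports Defs
begin

text \<open>
  Since \<open>dX\<close> lives on words of length one, the coefficient at \<open>w @ [i]\<close> of the equation is the recursive
  definition of the signature. The remaining point is integrability: the mixed partials are continuous
  up to the boundary of the square, and the integral of a continuous function over \<open>[s, r]\<close> is
  continuous in \<open>r\<close>, so that every coefficient is continuous by induction on the word.
\<close>

lemma tcoeff_sum: "tcoeff (\<Sum>j\<in>A. G j) w = (\<Sum>j\<in>A. tcoeff (G j) w)"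
  by (induction A rule: infinite_finite_induct)
     (simp_all add: zero_tensor_series.rep_eq plus_tensor_series.rep_eq)

lemma tcoeff_times_dX_density:
  "tcoeff (F * dX_density T X r) w = (\<Sum>j\<in>UNIV. mixed_partial T X j r * tcoeff (F * \<e> [j]) w)"
  by (simp add: dX_density_def sum_distrib_left tcoeff_sum scaleR_tensor_series.rep_eq)

text \<open>The only cut of the empty word has an empty suffix, and there each
  \<open>\<e> [j]\<close> has coefficient 0.\<close>

lemma tcoeff_times_dX_density_Nil: "tcoeff (F * dX_density T X r) [] = 0"
  unfolding tcoeff_times_dX_density by (simp add: times_tensor_series.rep_eq tensor_basis.rep_eq)

text \<open>Among the cuts of \<open>w @ [i]\<close>, only the one just before the last letter has a
  suffix of length one, so it alone can contribute.\<close>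

lemma tcoeff_times_letter_snoc:
  "tcoeff (F * \<e> [j]) (w @ [i]) = (if j = i then tcoeff F w else 0)"
proof -
  have *: "drop k (w @ [i]) = [j] \<longleftrightarrow> k = length w \<and> j = i" if "k \<le> Suc (length w)" for k
  proof
    assume d: "drop k (w @ [i]) = [j]"
    then have "length (drop k (w @ [i])) = 1" by simp
    with that have "k = length w" by simp
    with d show "k = length w \<and> j = i" by simp
  qed simp
  have "tcoeff (F * \<e> [j]) (w @ [i])
      = (\<Sum>k\<le>Suc (length w). if k = length w then (if j = i then tcoeff F w else 0) else 0)"
    unfolding times_tensor_series.rep_eq tensor_basis.rep_eq
    by (rule sum.cong) (use * in auto)
  then show ?thesis by simp
qed

lemma tcoeff_times_dX_density_snoc:
  "tcoeff (F * dX_density T X r) (w @ [i]) = tcoeff F w * mixed_partial T X i r"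
  by (simp add: tcoeff_times_dX_density tcoeff_times_letter_snoc mult.commute
      if_distrib [of "\<lambda>x. _ * x"] cong: if_cong)

text \<open>Chain rule along the horizontal segment of the square through \<open>r\<close>, whose
  velocity is \<open>(1, 0)\<close>.\<close>

lemma partial1_eq:
  fixes f :: "real \<times> real \<Rightarrow> real"
  assumes "0 < T" and r: "r \<in> cbox (0, 0) (T, T)"
    and f: "(f has_derivative f') (at r within cbox (0, 0) (T, T))"
  shows "partial1 T f r = f' (1, 0)"
proof -
  let ?line = "\<lambda>u. (u, snd r)"
  have fst_r: "fst r \<in> {0..T}" and sub: "?line ` {0..T} \<subseteq> cbox (0, 0) (T, T)"
    using r by (cases r; auto simp: cbox_Pair_eq)+
  have "(?line has_vector_derivative (1, 0)) (at (fst r) within {0..T})"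
    by (auto intro!: derivative_eq_intros)
  moreover have "(f has_derivative f') (at (?line (fst r)) within ?line ` {0..T})"
    using has_derivative_subset [OF f sub] by simp
  ultimately have "((f \<circ> ?line) has_vector_derivative f' (1, 0)) (at (fst r) within {0..T})"
    by (rule vector_derivative_diff_chain_within)
  \<comment> \<open>Since \<open>0 < T\<close>, the interval is nondegenerate, so derivatives within
    it are unique even at its endpoints and \<open>vector_derivative\<close> picks this one.\<close>
  then show ?thesis
    using vector_derivative_within_closed_interval [OF \<open>0 < T\<close> fst_r]
    by (simp add: partial1_def o_def)
qed

lemma partial2_eq:
  fixes f :: "real \<times> real \<Rightarrow> real"
  assumes "0 < T" and r: "r \<in> cbox (0, 0) (T, T)"
    and f: "(f has_derivative f') (at r within cbox (0, 0) (T, T))"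
  shows "partial2 T f r = f' (0, 1)"
proof -
  let ?line = "\<lambda>u. (fst r, u)"
  have snd_r: "snd r \<in> {0..T}" and sub: "?line ` {0..T} \<subseteq> cbox (0, 0) (T, T)"
    using r by (cases r; auto simp: cbox_Pair_eq)+
  have "(?line has_vector_derivative (0, 1)) (at (snd r) within {0..T})"
    by (auto intro!: derivative_eq_intros)
  moreover have "(f has_derivative f') (at (?line (snd r)) within ?line ` {0..T})"
    using has_derivative_subset [OF f sub] by simp
  ultimately have "((f \<circ> ?line) has_vector_derivative f' (0, 1)) (at (snd r) within {0..T})"
    by (rule vector_derivative_diff_chain_within)
  then show ?thesis
    using vector_derivative_within_closed_interval [OF \<open>0 < T\<close> snd_r]
    by (simp add: partial2_def o_def)
qed

text \<open>On the square the mixed partial is the continuous second derivative evaluated in the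
  directions \<open>(1, 0)\<close> and \<open>(0, 1)\<close>.\<close>

lemma continuous_on_mixed_partial:
  fixes X :: "real \<times> real \<Rightarrow> real ^ 'd::finite"
  assumes "0 < T" and X: "C2_on (cbox (0, 0) (T, T)) X"
  shows "continuous_on (cbox (0, 0) (T, T)) (mixed_partial T X i)"
proof -
  let ?Q = "cbox (0, 0) (T, T)"
  obtain X' :: "real \<times> real \<Rightarrow> (real \<times> real) \<Rightarrow>\<^sub>L (real ^ 'd)" and X'' where
    X': "\<And>x. x \<in> ?Q \<Longrightarrow> (X has_derivative blinfun_apply (X' x)) (at x within ?Q)" and
    X'': "\<And>x. x \<in> ?Q \<Longrightarrow> (X' has_derivative blinfun_apply (X'' x)) (at x within ?Q)" and
    cont: "continuous_on ?Q X''"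
    using X unfolding C2_on_def by blast
  have p2: "partial2 T (\<lambda>r. X r $ i) r = X' r (0, 1) $ i" if r: "r \<in> ?Q" for r
    by (rule partial2_eq [OF \<open>0 < T\<close> r])
       (rule bounded_linear.has_derivative [OF bounded_linear_vec_nth X' [OF r]])
  have mixed: "mixed_partial T X i r = X'' r (1, 0) (0, 1) $ i" if r: "r \<in> ?Q" for r
    unfolding mixed_partial_def
  proof (rule partial1_eq [OF \<open>0 < T\<close> r])
    \<comment> \<open>Evaluating an operator at a fixed vector and taking a coordinate is bounded
      linear, so it can be pulled through the derivative of \<open>X'\<close>.\<close>
    have "bounded_linear (\<lambda>A :: (real \<times> real) \<Rightarrow>\<^sub>L (real ^ 'd). A (0, 1) $ i)"
      by (rule bounded_linear_compose [OF bounded_linear_vec_nth blinfun.bounded_linear_left])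
    then have "((\<lambda>x. X' x (0, 1) $ i) has_derivative (\<lambda>h. X'' r h (0, 1) $ i)) (at r within ?Q)"
      by (rule bounded_linear.has_derivative [OF _ X'' [OF r]])
    \<comment> \<open>The formula \<open>p2\<close> holds only on the square, which suffices for a
      derivative within the square.\<close>
    then show "(partial2 T (\<lambda>r. X r $ i) has_derivative (\<lambda>h. X'' r h (0, 1) $ i)) (at r within ?Q)"
      by (rule has_derivative_transform [rotated 2]) (use r p2 in auto)
  qed
  have "continuous_on ?Q (\<lambda>r. X'' r (1, 0) (0, 1) $ i)"
    by (intro continuous_intros cont)
  then show ?thesis
    by (rule continuous_on_eq) (simp add: mixed)
qed

text \<open>The indefinite integral is uniformly continuous in both corners jointly; the lower one
  is frozen at \<open>a\<close>.\<close>

lemma continuous_on_integral_upper_corner: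
  fixes f :: "'a::euclidean_space \<Rightarrow> 'b::euclidean_space"
  assumes "f integrable_on cbox a b"
  shows "continuous_on (cbox a b) (\<lambda>r. integral (cbox a r) f)"
proof -
  have "continuous_on (cbox (a, a) (b, b)) (\<lambda>y. integral (cbox (fst y) (snd y)) f)"
    using assms
    by (intro uniformly_continuous_imp_continuous indefinite_integral_uniformly_continuous)
  moreover have "Pair a ` cbox a b \<subseteq> cbox (a, a) (b, b)"
  proof (rule image_subsetI)
    fix r assume "r \<in> cbox a b"
    \<comment> \<open>The point \<open>r\<close> witnesses that the box is nonempty, so its lower
      corner belongs to it.\<close>
    moreover from this have "a \<in> cbox a b" by (metis box_ne_empty(1) empty_iff mem_box(2) order_refl)
    ultimately show "(a, r) \<in> cbox (a, a) (b, b)" by (simp add: cbox_Pair_eq)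
  qed
  ultimately have "continuous_on (cbox a b) (\<lambda>r. integral (cbox (fst (a, r)) (snd (a, r))) f)"
    by (rule continuous_on_compose2 [OF _ continuous_on_Pair [OF continuous_on_const continuous_on_id]])
  then show ?thesis by simp
qed

text \<open>Continuity is the property that the induction can carry: it makes the next integrand
  integrable, and the integral is again continuous in its upper corner.\<close>

lemma continuous_on_id_sig_coeff:
  assumes "\<And>i. continuous_on (cbox s t) (mixed_partial T X i)"
  shows "continuous_on (cbox s t) (id_sig_coeff T X s w)"
proof (induction w rule: rev_induct)
  case Nil
  show ?case by (simp add: id_sig_coeff_Nil)
next
  case (snoc i w)
  have "(\<lambda>r. id_sig_coeff T X s w r * mixed_partial T X i r) integrable_on cbox s t"
    by (intro integrable_continuous continuous_intros snoc.IH assms)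
  from continuous_on_integral_upper_corner [OF this] show ?case
    by (simp add: id_sig_coeff_snoc)
qed

theorem proposition4p5:
  fixes T :: real and X :: "real \<times> real \<Rightarrow> real ^ 'd::finite" and s t :: "real \<times> real"
  assumes "T > 0"
    and "C2_on (cbox (0, 0) (T, T)) X"
    and "s \<in> cbox (0, 0) (T, T)" and "t \<in> cbox (0, 0) (T, T)"
    and "fst s \<le> fst t" and "snd s \<le> snd t"
  shows "(\<lambda>r. id_signature T X s r * dX_density T X r) tensor_integrable_on cbox s t \<and>
    id_signature T X s t =
      1 + tensor_integral (cbox s t) (\<lambda>r. id_signature T X s r * dX_density T X r)"
proof
  have tcoeff_sig: "tcoeff (id_signature T X s r) w = id_sig_coeff T X s w r" for r w
    by (simp add: id_signature_def Tensor_Series_inverse)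
  have "cbox s t \<subseteq> cbox (0, 0) (T, T)"
    using assms(3,4) by (cases s; cases t) (auto simp: cbox_Pair_eq)
  then have cont: "continuous_on (cbox s t) (mixed_partial T X i)" for i
    using continuous_on_mixed_partial [OF assms(1,2)] continuous_on_subset by blast
  show "(\<lambda>r. id_signature T X s r * dX_density T X r) tensor_integrable_on cbox s t"
    unfolding tensor_integrable_on_def
  proof
    fix w
    show "(\<lambda>r. tcoeff (id_signature T X s r * dX_density T X r) w) integrable_on cbox s t"
    proof (cases w rule: rev_cases)
      case Nil
      then show ?thesis by (simp add: tcoeff_times_dX_density_Nil integrable_0)
    next
      case (snoc v i)
      have "(\<lambda>r. id_sig_coeff T X s v r * mixed_partial T X i r) integrable_on cbox s t"
        by (intro integrable_continuous continuous_intros continuous_on_id_sig_coeff cont)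
      then show ?thesis by (simp add: snoc tcoeff_times_dX_density_snoc tcoeff_sig)
    qed
  qed
  show "id_signature T X s t =
      1 + tensor_integral (cbox s t) (\<lambda>r. id_signature T X s r * dX_density T X r)"
  proof (rule tensor_series_eqI)
    fix w
    show "tcoeff (id_signature T X s t) w =
      tcoeff (1 + tensor_integral (cbox s t) (\<lambda>r. id_signature T X s r * dX_density T X r)) w"
      \<comment> \<open>At the empty word the integrand vanishes and the unit gives 1; at
        \<open>v @ [i]\<close> the unit gives 0 and \<open>id_sig_coeff_snoc\<close>
        remains.\<close>
      by (cases w rule: rev_cases)
         (simp_all add: tcoeff_sig plus_tensor_series.rep_eq one_tensor_series.rep_eq
           tensor_integral_def Tensor_Series_inverse tcoeff_times_dX_density_Nil
           tcoeff_times_dX_density_snoc id_sig_coeff_Nil id_sig_coeff_snoc)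
  qed
qed

end
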